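(* Let $n\ge 2$ and let $\bm{m}=(m_1,\dots,m_n)$ be a vector of integers $m_i\ge 1$. Let $D(\bm{m})$ be the integral covering graph of $\bm m$. Then \[\mathrm{box}(D(\bm{m}))=\begin{cases} n & \text{if } \exists i\in [n]\colon m_i\ge 4,\\ n & \text{if } \exists i\in [n]\colon m_i=3 \text{ and } \exists j\in [n]\setminus\{i\}\colon m_j\ge 2,\\ n-1 & \text{if } \exists i\in [n]\colon m_i=3 \text{ and } \forall j\in [n]\setminus\{i\}\colon m_j=1,\\ n & \text{if } \bm{m}=(2,\dots,2),\\ n-1 & \text{if } \bm{m}\in\{1,2\}^n,\ \bm{m}\ne(2,\dots,2) \text{ and } \bm{m}\ne (1,1),\\ 0 & \text{if } \bm{m}=(1,1). \end{cases}\]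
   Context: $[n]=\{1,\dots,n\}$ and $[m]_0=\{0,1,\dots,m\}$. For $\bm{m}\in\mathbb{Z}_{\ge 1}^n$, the integral covering graph $D(\bm{m})$ has vertex set $\prod_{i=1}^n [m_i]_0\setminus\{\bm{0},\bm{m}\}$, where $\bm 0$ is the all-zero vector, and two distinct vertices $\bm v,\bm w$ are adjacent iff $v_i+w_i\ge m_i$ for all $i\in[n]$. The boxicity $\mathrm{box}(G)$ of a finite simple graph $G$ is the minimum integer $d\ge 0$ such that there exist $d$ interval graphs $I_1,\dots,I_d$ on the vertex set $V(G)$ with $E(G)=\bigcap_{j=1}^d E(I_j)$; the empty intersection ($d=0$) is the set of all pairs of vertices, so $\mathrm{box}(G)=0$ iff $G$ is complete. *)

theory Defs
  imports Complex_Main "HOL-Library.FuncSet" "HOL-Library.Ramsey"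
begin

text \<open>
  A simple graph is given by its vertex set \<open>V\<close> and its edge set \<open>E\<close>, a set of two-element
  subsets of \<open>V\<close>, i.e. a subset of \<^term>\<open>nsets V 2\<close>.
\<close>

definition interval_graph :: "'a set \<Rightarrow> 'a set set \<Rightarrow> bool" where
  "interval_graph V E \<longleftrightarrow>
     (\<exists>l r :: 'a \<Rightarrow> real.
        (\<forall>v\<in>V. l v \<le> r v) \<and>
        E = {{v, w} | v w. v \<in> V \<and> w \<in> V \<and> v \<noteq> w \<and> {l v..r v} \<inter> {l w..r w} \<noteq> {}})"

text \<open>
  Intersecting with \<^term>\<open>nsets V 2\<close> only matters for \<open>d = 0\<close>: there the empty intersection
  has to be the set of all pairs of vertices rather than \<^term>\<open>UNIV\<close>.
\<close>

definition box_rep :: "'a set \<Rightarrow> 'a set set \<Rightarrow> nat \<Rightarrow> bool" where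
  "box_rep V E d \<longleftrightarrow>
     (\<exists>I :: nat \<Rightarrow> 'a set set.
        (\<forall>j\<in>{1..d}. interval_graph V (I j)) \<and> E = nsets V 2 \<inter> (\<Inter>j\<in>{1..d}. I j))"

definition boxicity :: "'a set \<Rightarrow> 'a set set \<Rightarrow> nat" where
  "boxicity V E = (LEAST d. box_rep V E d)"

text \<open>
  A vector of length \<open>n\<close> is a function on \<^term>\<open>{1..n}\<close>. Vertices are extensional (\<^term>\<open>undefined\<close>
  outside \<^term>\<open>{1..n}\<close>), so that distinct functions are distinct vectors; the values of \<open>m\<close>
  outside \<^term>\<open>{1..n}\<close> are irrelevant.
\<close>

definition covering_verts :: "nat \<Rightarrow> (nat \<Rightarrow> nat) \<Rightarrow> (nat \<Rightarrow> nat) set" where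
  "covering_verts n m =
     (\<Pi>\<^sub>E i\<in>{1..n}. {0..m i}) - {(\<lambda>i\<in>{1..n}. 0), (\<lambda>i\<in>{1..n}. m i)}"

definition covering_edges :: "nat \<Rightarrow> (nat \<Rightarrow> nat) \<Rightarrow> (nat \<Rightarrow> nat) set set" where
  "covering_edges n m =
     {{v, w} | v w. v \<in> covering_verts n m \<and> w \<in> covering_verts n m \<and> v \<noteq> w \<and>
                    (\<forall>i\<in>{1..n}. v i + w i \<ge> m i)}"

lemma finite_covering_verts: "finite (covering_verts n m)"
  unfolding covering_verts_def by (intro finite_Diff finite_PiE) auto

lemma covering_edges_subset: "covering_edges n m \<subseteq> nsets (covering_verts n m) 2"
  by (auto simp: covering_edges_def nsets_def)

text \<open>The minimum in \<^const>\<open>boxicity\<close> is attained for every finite simple graph.\<close>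

lemma interval_graph_omit_pair:
  assumes "p \<in> nsets V 2"
  shows "interval_graph V (nsets V 2 - {p})"
proof -
  obtain a b where p: "p = {a, b}" "a \<noteq> b"
    using assms by (auto simp: nsets_def card_2_iff)
  define l where "l v = (if v = b then 1 else 0 :: real)" for v
  define r where "r v = (if v = a then 0 else 1 :: real)" for v
  have meet: "{v, w} \<noteq> p \<longleftrightarrow> {l v..r v} \<inter> {l w..r w} \<noteq> {}" if "v \<noteq> w" for v w
    using that p by (simp add: l_def r_def doubleton_eq_iff)
  have "nsets V 2 - {p} =
    {{v, w} | v w. v \<in> V \<and> w \<in> V \<and> v \<noteq> w \<and> {v, w} \<noteq> p}"
    by (rule set_eqI) (simp add: nsets_def card_2_iff, blast)
  also have "\<dots> =
    {{v, w} | v w. v \<in> V \<and> w \<in> V \<and> v \<noteq> w \<and> {l v..r v} \<inter> {l w..r w} \<noteq> {}}"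
    using meet by (intro Collect_cong ex_cong1 conj_cong refl)
  finally have "nsets V 2 - {p} =
    {{v, w} | v w. v \<in> V \<and> w \<in> V \<and> v \<noteq> w \<and> {l v..r v} \<inter> {l w..r w} \<noteq> {}}" .
  moreover have "\<forall>v\<in>V. l v \<le> r v"
    using p(2) by (simp add: l_def r_def)
  ultimately show ?thesis
    unfolding interval_graph_def by blast
qed

lemma box_rep_boxicity:
  assumes "finite V" "E \<subseteq> nsets V 2"
  shows "box_rep V E (boxicity V E)"
proof -
  let ?N = "nsets V 2 - E"
  have "finite ?N" using assms(1) by (simp add: finite_imp_finite_nsets)
  then obtain f where f: "bij_betw f {1..card ?N} ?N"
    using ex_bij_betw_nat_finite_1 by blast
  then have im: "f ` {1..card ?N} = ?N" by (rule bij_betw_imp_surj_on)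
  have "box_rep V E (card ?N)"
    unfolding box_rep_def
  proof (intro exI conjI ballI)
    fix j assume "j \<in> {1..card ?N}"
    then have "f j \<in> nsets V 2" using im by blast
    then show "interval_graph V (nsets V 2 - {f j})" by (rule interval_graph_omit_pair)
  next
    have "nsets V 2 \<inter> (\<Inter>j\<in>{1..card ?N}. nsets V 2 - {f j}) = nsets V 2 - f ` {1..card ?N}"
      by blast
    also have "\<dots> = E"
      unfolding im using assms(2) by (simp add: double_diff)
    finally show "E = nsets V 2 \<inter> (\<Inter>j\<in>{1..card ?N}. nsets V 2 - {f j})" by (rule sym)
  qed
  then show ?thesis unfolding boxicity_def by (rule LeastI)
qed

end

theory Submission
  imports Defs
begin

text \<open>
  Substitute \<open>u = m - v\<close>: then \<open>u\<close> and \<open>w\<close> are adjacent iff \<open>u + w \<le> m\<close> in every coordinate, and the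
  graph of a single coordinate is a threshold graph, hence an interval graph; so the boxicity is at
  most \<open>n\<close>. If some \<open>m p = 1\<close> and the other entries are at most 2, one graph can be saved: the
  interval graph of coordinate \<open>i\<close> is modified so that it also separates all pairs \<open>u, w\<close> with
  \<open>u p = w p = 1\<close> and \<open>u i \<noteq> w i\<close>. A similar trick works for \<open>(3, 1, \<dots>, 1)\<close>.

  For the lower bounds, choose for every nonadjacent pair one interval graph separating it. Two
  nonadjacent pairs with all four cross pairs adjacent get different graphs, since an interval graph
  has no induced 4-cycle. Explicit families of such pairs give all lower bounds, except for
  \<open>m = (1, \<dots>, 1)\<close>. There one considers the pairs \<open>{i}, {i, j}\<close> (as supports of 0/1-vectors) as arcs
  \<open>(i, j)\<close>: the arcs belonging to one graph pairwise intersect, so they form a star or lie in a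
  triangle, and not all six arcs of a triangle occur. Removing star centres and counting arcs shows
  that at least \<open>n - 1\<close> graphs are needed.
\<close>

section \<open>Translation of boxicity into interval families in complemented coordinates\<close>

text \<open>Vertices are in the complemented coordinates \<open>u = m - v\<close>.\<close>

definition interval_cover :: "nat \<Rightarrow> (nat \<Rightarrow> nat) \<Rightarrow> 'b set \<Rightarrow> bool" where
  "interval_cover n m J \<longleftrightarrow>
     (\<exists>l r :: 'b \<Rightarrow> (nat \<Rightarrow> nat) \<Rightarrow> real.
        (\<forall>j\<in>J. \<forall>u\<in>covering_verts n m. l j u \<le> r j u) \<and>
        (\<forall>u\<in>covering_verts n m. \<forall>w\<in>covering_verts n m. u \<noteq> w \<longrightarrow>
           ((\<forall>i\<in>{1..n}. u i + w i \<le> m i) \<longleftrightarrow> (\<forall>j\<in>J. l j u \<le> r j w \<and> l j w \<le> r j u))))"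

lemma doubleton_mem_iff:
  assumes "\<And>v w. B v w \<longleftrightarrow> B w v"
  shows "{v, w} \<in> {{v, w} | v w. v \<in> V \<and> w \<in> V \<and> v \<noteq> w \<and> B v w}
    \<longleftrightarrow> v \<in> V \<and> w \<in> V \<and> v \<noteq> w \<and> B v w"
  using assms by (auto simp: doubleton_eq_iff)

lemma subset_nsets2_eqI:
  assumes "E \<subseteq> nsets V 2" "F \<subseteq> nsets V 2"
    and "\<And>v w. \<lbrakk>v \<in> V; w \<in> V; v \<noteq> w\<rbrakk> \<Longrightarrow> {v, w} \<in> E \<longleftrightarrow> {v, w} \<in> F"
  shows "E = F"
proof (rule set_eqI)
  fix p
  show "p \<in> E \<longleftrightarrow> p \<in> F"
  proof (cases "p \<in> nsets V 2")
    case True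
    then obtain v w where "p = {v, w}" "v \<noteq> w" "v \<in> V" "w \<in> V"
      by (auto simp: nsets_def card_2_iff)
    then show ?thesis using assms(3) by simp
  qed (use assms in blast)
qed

lemma atLeastAtMost_Int_nonempty_iff:
  fixes a b c d :: real
  assumes "a \<le> b" "c \<le> d"
  shows "{a..b} \<inter> {c..d} \<noteq> {} \<longleftrightarrow> a \<le> d \<and> c \<le> b"
  using assms by auto

text \<open>Exposes the endpoint functions hidden in \<open>interval_graph\<close>, so that one
  choice of them can be fixed for each graph.\<close>

definition interval_model :: "'a set \<Rightarrow> 'a set set \<Rightarrow> ('a \<Rightarrow> real) \<Rightarrow> ('a \<Rightarrow> real) \<Rightarrow> bool" where
  "interval_model V E l r \<longleftrightarrow> (\<forall>v\<in>V. l v \<le> r v) \<and>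
     E = {{v, w} | v w. v \<in> V \<and> w \<in> V \<and> v \<noteq> w \<and> {l v..r v} \<inter> {l w..r w} \<noteq> {}}"

lemma interval_graph_iff_model: "interval_graph V E \<longleftrightarrow> (\<exists>l r. interval_model V E l r)"
  by (simp add: interval_graph_def interval_model_def)

lemma interval_model_le: "interval_model V E l r \<Longrightarrow> v \<in> V \<Longrightarrow> l v \<le> r v"
  by (simp add: interval_model_def)

lemma interval_model_mem_iff:
  assumes "interval_model V E l r" "v \<in> V" "w \<in> V" "v \<noteq> w"
  shows "{v, w} \<in> E \<longleftrightarrow> l v \<le> r w \<and> l w \<le> r v"
proof -
  have le: "l v \<le> r v" "l w \<le> r w"
    and E: "E = {{v, w} | v w. v \<in> V \<and> w \<in> V \<and> v \<noteq> w \<and> {l v..r v} \<inter> {l w..r w} \<noteq> {}}"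
    using assms by (simp_all add: interval_model_def)
  have "{v, w} \<in> E \<longleftrightarrow> v \<in> V \<and> w \<in> V \<and> v \<noteq> w \<and> {l v..r v} \<inter> {l w..r w} \<noteq> {}"
    unfolding E by (rule doubleton_mem_iff) (simp add: Int_commute)
  then show ?thesis
    using assms(2-4) atLeastAtMost_Int_nonempty_iff[OF le] by simp
qed

definition compl :: "nat \<Rightarrow> (nat \<Rightarrow> nat) \<Rightarrow> (nat \<Rightarrow> nat) \<Rightarrow> nat \<Rightarrow> nat" where
  "compl n m v = (\<lambda>i\<in>{1..n}. m i - v i)"

lemma covering_verts_iff:
  "v \<in> covering_verts n m \<longleftrightarrow> v \<in> extensional {1..n} \<and> (\<forall>i\<in>{1..n}. v i \<le> m i) \<and>
     (\<exists>i\<in>{1..n}. v i \<noteq> 0) \<and> (\<exists>i\<in>{1..n}. v i \<noteq> m i)"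
proof -
  have *: "v \<noteq> (\<lambda>i\<in>{1..n}. f i) \<longleftrightarrow> (\<exists>i\<in>{1..n}. v i \<noteq> f i)" if "v \<in> extensional {1..n}" for f
  proof -
    have "v = (\<lambda>i\<in>{1..n}. f i)" if "\<forall>i\<in>{1..n}. v i = f i"
      by (rule extensionalityI[of _ "{1..n}"]) (use that \<open>v \<in> extensional {1..n}\<close> in auto)
    moreover have "\<forall>i\<in>{1..n}. v i = f i" if "v = (\<lambda>i\<in>{1..n}. f i)"
      using that by simp
    ultimately show ?thesis by blast
  qed
  have mem: "v \<in> covering_verts n m \<longleftrightarrow> v \<in> extensional {1..n} \<and> (\<forall>i\<in>{1..n}. v i \<le> m i) \<and>
    v \<noteq> (\<lambda>i\<in>{1..n}. 0) \<and> v \<noteq> (\<lambda>i\<in>{1..n}. m i)"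
    by (auto simp: covering_verts_def PiE_iff)
  show ?thesis
  proof (cases "v \<in> extensional {1..n}")
    case True
    show ?thesis unfolding mem *[OF True, of "\<lambda>_. 0"] *[OF True, of m] by (rule refl)
  qed (simp add: mem)
qed

lemma covering_verts_le: "v \<in> covering_verts n m \<Longrightarrow> i \<in> {1..n} \<Longrightarrow> v i \<le> m i"
  by (simp add: covering_verts_iff)

lemma covering_verts_eqI:
  assumes "v \<in> covering_verts n m" "w \<in> covering_verts n m"
    and "\<And>i. i \<in> {1..n} \<Longrightarrow> v i = w i"
  shows "v = w"
  by (rule extensionalityI[of _ "{1..n}"]) (use assms in \<open>auto simp: covering_verts_iff\<close>)

lemma compl_mem:
  assumes "v \<in> covering_verts n m"
  shows "compl n m v \<in> covering_verts n m"
proof -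
  obtain i k where "i \<in> {1..n}" "v i \<noteq> 0" "k \<in> {1..n}" "v k \<noteq> m k"
    and le: "\<forall>i\<in>{1..n}. v i \<le> m i"
    using assms unfolding covering_verts_iff by blast
  then have "v i \<le> m i" "v k < m k" by (auto simp: le_less)
  then have "compl n m v i \<noteq> m i" "compl n m v k \<noteq> 0"
    using \<open>i \<in> {1..n}\<close> \<open>v i \<noteq> 0\<close> \<open>k \<in> {1..n}\<close> by (simp_all add: compl_def)
  then have "\<exists>i\<in>{1..n}. compl n m v i \<noteq> 0" "\<exists>i\<in>{1..n}. compl n m v i \<noteq> m i"
    using \<open>i \<in> {1..n}\<close> \<open>k \<in> {1..n}\<close> by blast+
  moreover have "compl n m v \<in> extensional {1..n}" "\<forall>i\<in>{1..n}. compl n m v i \<le> m i"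
    by (simp_all add: compl_def)
  ultimately show ?thesis
    unfolding covering_verts_iff by blast
qed

lemma compl_compl: "v \<in> covering_verts n m \<Longrightarrow> compl n m (compl n m v) = v"
  by (rule extensionalityI[of _ "{1..n}"]) (auto simp: covering_verts_iff compl_def)

lemma compl_add_le_iff:
  assumes "v \<in> covering_verts n m" "w \<in> covering_verts n m"
  shows "(\<forall>i\<in>{1..n}. compl n m v i + compl n m w i \<le> m i) \<longleftrightarrow> (\<forall>i\<in>{1..n}. v i + w i \<ge> m i)"
proof (intro ball_cong refl)
  fix i assume "i \<in> {1..n}"
  then show "compl n m v i + compl n m w i \<le> m i \<longleftrightarrow> v i + w i \<ge> m i"
    using covering_verts_le[OF assms(1), of i] covering_verts_le[OF assms(2), of i]
    by (simp add: compl_def) arith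
qed

lemma covering_edges_mem_iff:
  assumes "v \<in> covering_verts n m" "w \<in> covering_verts n m" "v \<noteq> w"
  shows "{v, w} \<in> covering_edges n m \<longleftrightarrow> (\<forall>i\<in>{1..n}. v i + w i \<ge> m i)"
proof -
  have "{v, w} \<in> covering_edges n m \<longleftrightarrow> v \<in> covering_verts n m \<and> w \<in> covering_verts n m \<and>
    v \<noteq> w \<and> (\<forall>i\<in>{1..n}. v i + w i \<ge> m i)"
    unfolding covering_edges_def by (rule doubleton_mem_iff) (simp only: add.commute)
  then show ?thesis using assms by simp
qed

text \<open>\<open>compl\<close> is an involution of the vertices that turns
  \<open>v i + w i \<ge> m i\<close> into the complemented condition, so it suffices to precompose
  the endpoint functions with it.\<close>

lemma interval_cover_if_box_rep:
  assumes "box_rep (covering_verts n m) (covering_edges n m) d"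
  shows "interval_cover n m {1..d}"
proof -
  let ?V = "covering_verts n m"
  obtain I where I: "\<forall>j\<in>{1..d}. interval_graph ?V (I j)"
    and E: "covering_edges n m = nsets ?V 2 \<inter> (\<Inter>j\<in>{1..d}. I j)"
    using assms unfolding box_rep_def by blast
  obtain l r where lr: "\<And>j. j \<in> {1..d} \<Longrightarrow> interval_model ?V (I j) (l j) (r j)"
    using I unfolding interval_graph_iff_model by metis
  let ?l = "\<lambda>j u. l j (compl n m u)" and ?r = "\<lambda>j u. r j (compl n m u)"
  show ?thesis unfolding interval_cover_def
  proof (rule exI[of _ ?l], rule exI[of _ ?r], intro conjI ballI impI)
    fix j u assume "j \<in> {1..d}" "u \<in> ?V"
    then show "?l j u \<le> ?r j u" using interval_model_le[OF lr compl_mem] by blast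
  next
    fix u w assume uw: "u \<in> ?V" "w \<in> ?V" "u \<noteq> w"
    let ?u = "compl n m u" and ?w = "compl n m w"
    have cuw: "?u \<in> ?V" "?w \<in> ?V" "?u \<noteq> ?w"
      using uw compl_mem compl_compl by metis+
    have "(\<forall>i\<in>{1..n}. u i + w i \<le> m i) \<longleftrightarrow> (\<forall>i\<in>{1..n}. ?u i + ?w i \<ge> m i)"
      using compl_add_le_iff[OF cuw(1,2)] compl_compl[OF uw(1)] compl_compl[OF uw(2)] by simp
    also have "\<dots> \<longleftrightarrow> {?u, ?w} \<in> covering_edges n m"
      by (rule covering_edges_mem_iff[OF cuw, symmetric])
    also have "\<dots> \<longleftrightarrow> (\<forall>j\<in>{1..d}. {?u, ?w} \<in> I j)"
      unfolding E using cuw by (simp add: nsets_def)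
    also have "\<dots> \<longleftrightarrow> (\<forall>j\<in>{1..d}. ?l j u \<le> ?r j w \<and> ?l j w \<le> ?r j u)"
      using lr interval_model_mem_iff[OF _ cuw] by (intro ball_cong refl) blast
    finally show "(\<forall>i\<in>{1..n}. u i + w i \<le> m i) \<longleftrightarrow>
      (\<forall>j\<in>{1..d}. ?l j u \<le> ?r j w \<and> ?l j w \<le> ?r j u)" .
  qed
qed

text \<open>Precomposition with \<open>compl\<close> in the other direction. The index set
  \<open>J\<close> is arbitrary because the covers constructed below are indexed by coordinates,
  sometimes with one omitted; an enumeration \<open>f\<close> of \<open>J\<close> renumbers
  them.\<close>

lemma box_rep_if_interval_cover:
  assumes "interval_cover n m J" "finite J"
  shows "box_rep (covering_verts n m) (covering_edges n m) (card J)"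
proof -
  let ?V = "covering_verts n m"
  obtain l r where le: "\<And>j u. j \<in> J \<Longrightarrow> u \<in> ?V \<Longrightarrow> l j u \<le> (r j u :: real)"
    and adj: "\<And>u w. \<lbrakk>u \<in> ?V; w \<in> ?V; u \<noteq> w\<rbrakk> \<Longrightarrow>
      (\<forall>i\<in>{1..n}. u i + w i \<le> m i) \<longleftrightarrow> (\<forall>j\<in>J. l j u \<le> r j w \<and> l j w \<le> r j u)"
    using assms(1) unfolding interval_cover_def by blast
  obtain f where "bij_betw f {1..card J} J"
    using assms(2) ex_bij_betw_nat_finite_1 by blast
  then have f: "f ` {1..card J} = J" by (rule bij_betw_imp_surj_on)
  define l' where "l' j v = l (f j) (compl n m v)" for j v
  define r' where "r' j v = r (f j) (compl n m v)" for j v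
  define I where "I j = {{v, w} | v w. v \<in> ?V \<and> w \<in> ?V \<and> v \<noteq> w \<and>
    {l' j v..r' j v} \<inter> {l' j w..r' j w} \<noteq> {}}" for j
  have model: "interval_model ?V (I j) (l' j) (r' j)" if "j \<in> {1..card J}" for j
  proof -
    have "\<forall>v\<in>?V. l' j v \<le> r' j v"
      unfolding l'_def r'_def using le f that compl_mem by blast
    then show ?thesis by (simp add: interval_model_def I_def)
  qed
  have "covering_edges n m = nsets ?V 2 \<inter> (\<Inter>j\<in>{1..card J}. I j)"
  proof (rule subset_nsets2_eqI[OF covering_edges_subset])
    fix v w assume vw: "v \<in> ?V" "w \<in> ?V" "v \<noteq> w"
    let ?v = "compl n m v" and ?w = "compl n m w"
    have cvw: "?v \<in> ?V" "?w \<in> ?V" "?v \<noteq> ?w"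
      using vw compl_mem compl_compl by metis+
    have "{v, w} \<in> covering_edges n m \<longleftrightarrow> (\<forall>i\<in>{1..n}. ?v i + ?w i \<le> m i)"
      using covering_edges_mem_iff[OF vw] compl_add_le_iff[OF vw(1,2)] by simp
    also have "\<dots> \<longleftrightarrow> (\<forall>j\<in>f ` {1..card J}. l j ?v \<le> r j ?w \<and> l j ?w \<le> r j ?v)"
      unfolding f by (rule adj[OF cvw])
    also have "\<dots> \<longleftrightarrow> (\<forall>j\<in>{1..card J}. l' j v \<le> r' j w \<and> l' j w \<le> r' j v)"
      by (simp add: l'_def r'_def)
    also have "\<dots> \<longleftrightarrow> (\<forall>j\<in>{1..card J}. {v, w} \<in> I j)"
      using interval_model_mem_iff[OF model vw] by (intro ball_cong refl) blast
    also have "\<dots> \<longleftrightarrow> {v, w} \<in> nsets ?V 2 \<inter> (\<Inter>j\<in>{1..card J}. I j)"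
      using vw by (simp add: nsets_def)
    finally show "{v, w} \<in> covering_edges n m \<longleftrightarrow> {v, w} \<in> nsets ?V 2 \<inter> (\<Inter>j\<in>{1..card J}. I j)" .
  qed simp
  moreover have "\<forall>j\<in>{1..card J}. interval_graph ?V (I j)"
    unfolding interval_graph_iff_model using model by blast
  ultimately show ?thesis unfolding box_rep_def by blast
qed

lemma boxicity_covering_eqI:
  fixes J :: "'b set"
  assumes "interval_cover n m J" "finite J"
    and "\<And>d. interval_cover n m {1..d} \<Longrightarrow> card J \<le> d"
  shows "boxicity (covering_verts n m) (covering_edges n m) = card J"
  unfolding boxicity_def
proof (rule Least_equality)
  show "box_rep (covering_verts n m) (covering_edges n m) (card J)"
    by (rule box_rep_if_interval_cover[OF assms(1,2)])
  show "card J \<le> d" if "box_rep (covering_verts n m) (covering_edges n m) d" for d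
    by (rule assms(3)[OF interval_cover_if_box_rep[OF that]])
qed

section \<open>Upper bounds by explicit intervals\<close>

text \<open>These perturbations make vertices with equal coordinates distinct points of the line.
  Being below 1/2, they do not disturb the comparisons of integer coordinates that encode
  adjacency.\<close>

lemma ex_small_inj:
  assumes "finite V"
  obtains e :: "'a \<Rightarrow> real" where "\<And>v w. \<lbrakk>v \<in> V; w \<in> V; v \<noteq> w\<rbrakk> \<Longrightarrow> e v \<noteq> e w"
    and "\<And>v. 0 < e v" "\<And>v. e v < 1/2"
proof -
  obtain f :: "'a \<Rightarrow> nat" where f: "inj_on f V"
    using finite_imp_inj_to_nat_seg[OF assms] by blast
  show thesis
  proof (rule that[of "\<lambda>v. 1 / (real (f v) + 3)"])
    show "1 / (real (f v) + 3) \<noteq> 1 / (real (f w) + 3)" if "v \<in> V" "w \<in> V" "v \<noteq> w" for v w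
      using inj_onD[OF f _ that(1,2)] that(3) by auto
    show "0 < 1 / (real (f v) + 3)" "1 / (real (f v) + 3) < 1 / 2" for v
      by (simp_all add: field_simps add_pos_nonneg)
  qed
qed

lemma of_nat_shift_le_iff:
  fixes e :: real
  assumes "0 \<le> e" "e < 1"
  shows "real x - e \<le> real y \<longleftrightarrow> x \<le> y"
proof
  assume "real x - e \<le> real y"
  then have "real x < real (Suc y)" using assms(2) by simp
  then show "x \<le> y" by (simp only: of_nat_less_iff less_Suc_eq_le)
next
  assume "x \<le> y"
  then have "real x \<le> real y" by simp
  then show "real x - e \<le> real y" using assms(1) by linarith
qed

lemma interval_cover_upper:
  assumes m1: "\<forall>i\<in>{1..n}. m i \<ge> 1"
  shows "interval_cover n m {1..n}"
proof -
  let ?V = "covering_verts n m"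
  obtain e where e: "\<And>v w. \<lbrakk>v \<in> ?V; w \<in> ?V; v \<noteq> w\<rbrakk> \<Longrightarrow> e v \<noteq> e w"
    and e0: "\<And>v. 0 < e v" and e2: "\<And>v. e v < (1/2 :: real)"
    using ex_small_inj[OF finite_covering_verts[of n m]] by blast
  \<comment> \<open>Vertices with \<open>2 * u i \<le> m i\<close> are pairwise compatible in
    coordinate \<open>i\<close> and get intervals starting at 0. The others are pairwise
    incompatible and become distinct points; such a point \<open>u i - e u\<close> lies in the
    interval of a small \<open>w\<close> iff \<open>u i \<le> m i - w i\<close>.\<close>
  define l where "l i u = (if 2 * u i \<le> m i then 0 else real (u i) - e u)" for i u
  define r where "r i u = (if 2 * u i \<le> m i then real (m i) - real (u i) else real (u i) - e u)" for i u
  show ?thesis unfolding interval_cover_def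
  proof (rule exI[of _ l], rule exI[of _ r], intro conjI ballI impI)
    fix i u assume "i \<in> {1..n}" "u \<in> ?V"
    then show "l i u \<le> r i u" using covering_verts_le[of u n m i] by (simp add: l_def r_def)
  next
    fix u w assume uw: "u \<in> ?V" "w \<in> ?V" "u \<noteq> w"
    show "(\<forall>i\<in>{1..n}. u i + w i \<le> m i) \<longleftrightarrow> (\<forall>i\<in>{1..n}. l i u \<le> r i w \<and> l i w \<le> r i u)"
    proof (intro ball_cong refl)
      fix i assume i: "i \<in> {1..n}"
      have ui: "u i \<le> m i" "w i \<le> m i" "m i \<ge> 1" using uw i covering_verts_le m1 by auto
      have P: "real x - e y \<le> real (m i) - real z \<longleftrightarrow> x + z \<le> m i" if "z \<le> m i" for x y z
        using of_nat_shift_le_iff[of "e y" x "m i - z"] e0[of y] e2[of y] that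
        by (simp add: of_nat_diff le_diff_conv2)
      have Q: "real x - e u \<noteq> real y - e w" for x y
      proof
        assume *: "real x - e u = real y - e w"
        then have "x \<le> y" "y \<le> x"
          using e0[of u] e2[of u] e0[of w] e2[of w]
            of_nat_shift_le_iff[of "e u" x y] of_nat_shift_le_iff[of "e w" y x] by auto
        then show False using e[OF uw] * by simp
      qed
      consider "2 * u i \<le> m i" "2 * w i \<le> m i" | "2 * u i \<le> m i" "\<not> 2 * w i \<le> m i"
        | "\<not> 2 * u i \<le> m i" "2 * w i \<le> m i" | "\<not> 2 * u i \<le> m i" "\<not> 2 * w i \<le> m i" by blast
      then show "u i + w i \<le> m i \<longleftrightarrow> l i u \<le> r i w \<and> l i w \<le> r i u"
      proof cases
        case 1
        then show ?thesis using ui by (simp add: l_def r_def)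
      next
        case 2
        then have "1 \<le> w i" by linarith
        then have "0 \<le> real (w i) - e w" using e2[of w] by linarith
        then show ?thesis using 2 P[of "u i" "w i" w] ui by (simp add: l_def r_def add.commute)
      next
        case 3
        then have "1 \<le> u i" by linarith
        then have "0 \<le> real (u i) - e u" using e2[of u] by linarith
        then show ?thesis using 3 P[of "w i" "u i" u] ui by (simp add: l_def r_def)
      next
        case 4
        then show ?thesis using Q[of "u i" "w i"] by (simp add: l_def r_def)
      qed
    qed
  qed
qed

text \<open>A pair violating \<open>p\<close> has \<open>u p = w p = 1\<close>. Being distinct, its
  vertices differ in some other coordinate \<open>i\<close>, whose modified graph then separates
  them.\<close>

lemma interval_cover_one_two:
  assumes p: "p \<in> {1..n}" "m p = 1" and m12: "\<forall>i\<in>{1..n}. m i \<in> {1, 2}"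
  shows "interval_cover n m ({1..n} - {p})"
proof -
  let ?V = "covering_verts n m"
  obtain e where e: "\<And>v w. \<lbrakk>v \<in> ?V; w \<in> ?V; v \<noteq> w\<rbrakk> \<Longrightarrow> e v \<noteq> e w"
    and e0: "\<And>v. 0 < e v" and e2: "\<And>v. e v < (1/2 :: real)"
    using ex_small_inj[OF finite_covering_verts[of n m]] by blast
  \<comment> \<open>Vertices with \<open>u i = m i\<close> are points, in (1, 3/2) for
    \<open>u p = 0\<close> and in (-2, -3/2) for \<open>u p = 1\<close>. For \<open>u i = 0\<close>
    the interval is [-3, 3], which meets everything, or [0, 3] if \<open>u p = 1\<close>, which
    misses the points on the left. The middle value, possible for \<open>m i = 2\<close> only, gives
    [-1, 0], or a point in (-1/2, 0) if \<open>u p = 1\<close>, which [0, 3] misses as well.\<close>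
  define l where "l i u = (if u i = m i then (if u p = 0 then 1 + e u else e u - 2)
    else if u i = 0 then (if u p = 0 then -3 else 0)
    else if u p = 0 then -1 else - e u)" for i u
  define r where "r i u = (if u i = m i then (if u p = 0 then 1 + e u else e u - 2)
    else if u i = 0 then 3
    else if u p = 0 then 0 else - e u)" for i u
  have vals: "u i = 0 \<or> u i = 1 \<or> u i = 2 \<and> m i = 2" if "u \<in> ?V" "i \<in> {1..n}" for u i
    using covering_verts_le[OF that] m12 that(2) by fastforce
  have mi: "m i = 1 \<or> m i = 2" if "i \<in> {1..n}" for i
    using m12 that by blast
  have valp: "u p = 0 \<or> u p = 1" if "u \<in> ?V" for u
    using covering_verts_le[OF that p(1)] p(2) by auto
  have meet: "l i u \<le> r i w"
    if "u \<in> ?V" "w \<in> ?V" "i \<in> {1..n}" "u i + w i \<le> m i" "u p + w p \<le> 1" for i u w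
    using mi[OF that(3)] vals[OF that(1,3)] vals[OF that(2,3)] valp[OF that(1)] valp[OF that(2)] that(4,5)
      e0[of u] e2[of u] e0[of w] e2[of w]
    by (elim disjE) (simp_all add: l_def r_def)
  have separate: "\<not> (l i u \<le> r i w \<and> l i w \<le> r i u)"
    if "u \<in> ?V" "w \<in> ?V" "u \<noteq> w" "i \<in> {1..n}" "u i + w i > m i \<or> u p + w p > 1 \<and> u i \<noteq> w i" for i u w
    using mi[OF that(4)] vals[OF that(1,4)] vals[OF that(2,4)] valp[OF that(1)] valp[OF that(2)] that(5)
      e0[of u] e2[of u] e0[of w] e2[of w] e[OF that(1-3)]
    by (elim disjE) (simp_all add: l_def r_def)
  show ?thesis unfolding interval_cover_def
  proof (rule exI[of _ l], rule exI[of _ r], intro conjI ballI impI)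
    fix i u assume "i \<in> {1..n} - {p}" "u \<in> ?V"
    then show "l i u \<le> r i u" using e0[of u] by (simp add: l_def r_def)
  next
    fix u w assume uw: "u \<in> ?V" "w \<in> ?V" "u \<noteq> w"
    show "(\<forall>i\<in>{1..n}. u i + w i \<le> m i) \<longleftrightarrow> (\<forall>i\<in>{1..n} - {p}. l i u \<le> r i w \<and> l i w \<le> r i u)"
    proof (intro iffI ballI conjI)
      fix i assume le: "\<forall>i\<in>{1..n}. u i + w i \<le> m i" and i: "i \<in> {1..n} - {p}"
      have "u i + w i \<le> m i" "u p + w p \<le> 1" using le[rule_format, of i] le[rule_format, of p] i p by auto
      then show "l i u \<le> r i w" "l i w \<le> r i u"
        using i uw(1,2) by (intro meet; simp add: add.commute)+
    next
      fix k assume meets: "\<forall>i\<in>{1..n} - {p}. l i u \<le> r i w \<and> l i w \<le> r i u" and k: "k \<in> {1..n}"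
      show "u k + w k \<le> m k"
      proof (rule ccontr)
        assume gt: "\<not> u k + w k \<le> m k"
        show False
        proof (cases "k = p")
          case False
          then show False using separate[OF uw k] gt meets k by auto
        next
          case True
          then have "u p + w p > 1" using gt p(2) by simp
          moreover from this have "u p = w p" using valp[OF uw(1)] valp[OF uw(2)] by auto
          moreover obtain i where "i \<in> {1..n}" "u i \<noteq> w i"
            using uw covering_verts_eqI by blast
          ultimately show False using separate[OF uw, of i] meets by auto
        qed
      qed
    qed
  qed
qed

text \<open>The graph of a coordinate \<open>j\<close> other than \<open>q\<close> also separates pairs with \<open>u j \<noteq> w j\<close> if they violate
  coordinate \<open>i\<close>, or if they violate \<open>q\<close> and have \<open>u i = w i = 0\<close>. So the graph of \<open>q\<close> need not
  separate the latter, and this leaves room to separate the pairs that violate \<open>i\<close> and vanish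
  outside \<open>{i, q}\<close>.\<close>

lemma interval_cover_three_one:
  assumes i: "i \<in> {1..n}" "m i = 3" and q: "q \<in> {1..n}" "q \<noteq> i"
    and m1: "\<forall>j\<in>{1..n} - {i}. m j = 1"
  shows "interval_cover n m ({1..n} - {i})"
proof -
  let ?V = "covering_verts n m"
  obtain e where e: "\<And>v w. \<lbrakk>v \<in> ?V; w \<in> ?V; v \<noteq> w\<rbrakk> \<Longrightarrow> e v \<noteq> e w"
    and e0: "\<And>v. 0 < e v" and e2: "\<And>v. e v < (1/2 :: real)"
    using ex_small_inj[OF finite_covering_verts[of n m]] by blast
  \<comment> \<open>The position of a vertex with \<open>u j = 1\<close>; for \<open>j = q\<close>
    it is used only if \<open>u i > 0\<close>. For \<open>j \<noteq> q\<close>, vertices with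
    \<open>u i = 0\<close> and \<open>u q = 1\<close> are moved to (-1, -1/2), where intervals
    starting at 0 miss them.\<close>
  define pnt where "pnt j u =
    (if j = q then real (u i) - e u
     else if u i = 0 \<and> u q = 1 then e u - 1 else real (u i) + e u)" for j u
  \<comment> \<open>For \<open>j \<noteq> q\<close>, the interval of a vertex with
    \<open>u j = 0\<close> contains a point \<open>w i + e w\<close> iff
    \<open>u i + w i \<le> 3\<close>; the left end 0 in case \<open>u q = 1\<close> misses the moved
    points. For \<open>j = q\<close>, the intervals with \<open>u q = 0\<close> are [-1, 3], [0, 2],
    [0, 1], {-1} for \<open>u i = 0, 1, 2, 3\<close>. The interval [-1, 0] for
    \<open>u q = 1\<close>, \<open>u i = 0\<close> touches all four, and a point
    \<open>w i - e w\<close> lies in one of them iff \<open>u i + w i \<le> 3\<close>.\<close>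
  define l where "l j u =
    (if j = q then
       (if u q = 1 then (if u i = 0 then -1 else pnt j u)
        else if u i = 0 \<or> u i = 3 then -1 else 0)
     else if u j = 1 then pnt j u
     else if u q = 0 then -1 else 0)" for j u
  define r where "r j u =
    (if j = q then
       (if u q = 1 then (if u i = 0 then 0 else pnt j u)
        else if u i = 3 then -1 else 3 - real (u i))
     else if u j = 1 then pnt j u
     else 7/2 - real (u i))" for j u
  have vali: "u i = 0 \<or> u i = 1 \<or> u i = 2 \<or> u i = 3" if "u \<in> ?V" for u
    using covering_verts_le[OF that i(1)] i(2) by auto
  have valj: "u j = 0 \<or> u j = 1" if "u \<in> ?V" "j \<in> {1..n} - {i}" for u j
    using covering_verts_le[OF that(1), of j] m1 that(2) by fastforce
  have qi: "q \<in> {1..n} - {i}" using q by simp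
  have meet_q: "l q u \<le> r q w"
    if "u \<in> ?V" "w \<in> ?V" "u i + w i \<le> 3" "u q + w q \<le> 1" for u w
    using vali[OF that(1)] vali[OF that(2)] valj[OF that(1) qi] valj[OF that(2) qi]
      that(3,4) e0[of u] e2[of u] e0[of w] e2[of w]
    by (elim disjE; simp add: l_def r_def pnt_def)
  have meet: "l j u \<le> r j w"
    if "u \<in> ?V" "w \<in> ?V" "j \<in> {1..n} - {i}" "j \<noteq> q"
      "u i + w i \<le> 3" "u q + w q \<le> 1" "u j + w j \<le> 1" for j u w
  proof -
    have pnt_le: "pnt j v \<le> real (v i) + 1/2" and pnt_ge: "-1 \<le> pnt j v" "v q = 0 \<Longrightarrow> 0 \<le> pnt j v" for v
      using e0[of v] e2[of v] \<open>j \<noteq> q\<close> by (auto simp: pnt_def)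
    have "real (u i) + real (w i) \<le> 3" using that(5) by linarith
    then show ?thesis
      using valj[OF that(1,3)] valj[OF that(2,3)] that(4,6,7) pnt_le[of u] pnt_ge[of w]
        valj[OF that(1) qi]
      by (elim disjE) (simp_all add: l_def r_def)
  qed
  have separate: "\<not> (l j u \<le> r j w \<and> l j w \<le> r j u)"
    if "u \<in> ?V" "w \<in> ?V" "u \<noteq> w" "j \<in> {1..n} - {i}" "j \<noteq> q"
      "u j + w j > 1 \<or> u j \<noteq> w j \<and> (u i + w i > 3 \<or> u q + w q > 1 \<and> u i = 0 \<and> w i = 0)" for j u w
  proof -
    note uwj = that
    have sep: "r j y < l j x"
      if "x \<in> ?V" "y \<in> ?V" "x j = 1" "y j = 0" "x i + y i > 3" for x y
    proof -
      have "x i \<noteq> 0" using vali[OF that(2)] that(5) by auto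
      moreover have "real (x i) + real (y i) \<ge> 4" using that(5) by linarith
      ultimately show ?thesis using \<open>j \<noteq> q\<close> that(3,4) e0[of x] by (simp add: l_def r_def pnt_def)
    qed
    have sep0: "r j x < l j y"
      if "x \<in> ?V" "y \<in> ?V" "x j = 1" "y j = 0" "x q + y q > 1" "x i = 0" "y i = 0" for x y
      using valj[OF that(1) qi] valj[OF that(2) qi] \<open>j \<noteq> q\<close> that(3-7) e2[of x]
      by (auto simp: l_def r_def pnt_def)
    show ?thesis
    proof (cases "u j = w j")
      case True
      then have "u j = 1" "w j = 1" using uwj(6) valj[OF uwj(1,4)] by auto
      moreover have "pnt j u \<noteq> pnt j w"
        using vali[OF uwj(1)] vali[OF uwj(2)] e0[of u] e2[of u] e0[of w] e2[of w] e[OF uwj(1-3)]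
        by (elim disjE) (simp_all add: pnt_def)
      ultimately show ?thesis using \<open>j \<noteq> q\<close> by (simp add: l_def r_def)
    next
      case False
      then consider "u j = 1" "w j = 0" | "u j = 0" "w j = 1"
        using valj[OF uwj(1,4)] valj[OF uwj(2,4)] by auto
      then show ?thesis
      proof cases
        case 1
        then show ?thesis using uwj(1,2,6) sep[of u w] sep0[of u w] by auto
      next
        case 2
        then show ?thesis using uwj(1,2,6) sep[of w u] sep0[of w u] by (auto simp: add.commute)
      qed
    qed
  qed
  have separate_q: "\<not> (l q u \<le> r q w \<and> l q w \<le> r q u)"
    if "u \<in> ?V" "w \<in> ?V" "u \<noteq> w"
      "u q + w q > 1 \<and> (u i \<noteq> 0 \<or> w i \<noteq> 0) \<or> u i + w i > 3 \<and> (u i \<noteq> w i \<or> u q \<noteq> w q)" for u w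
    using vali[OF that(1)] vali[OF that(2)] valj[OF that(1) qi] valj[OF that(2) qi]
      that(4) e0[of u] e2[of u] e0[of w] e2[of w] e[OF that(1-3)]
    by (elim disjE; simp add: l_def r_def pnt_def)
  show ?thesis unfolding interval_cover_def
  proof (rule exI[of _ l], rule exI[of _ r], intro conjI ballI impI)
    fix j u assume j: "j \<in> {1..n} - {i}" and u: "u \<in> ?V"
    show "l j u \<le> r j u" using vali[OF u] by (elim disjE) (simp_all add: l_def r_def)
  next
    fix u w assume uw: "u \<in> ?V" "w \<in> ?V" "u \<noteq> w"
    show "(\<forall>k\<in>{1..n}. u k + w k \<le> m k) \<longleftrightarrow> (\<forall>j\<in>{1..n} - {i}. l j u \<le> r j w \<and> l j w \<le> r j u)"
    proof (intro iffI ballI conjI)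
      fix j assume le: "\<forall>k\<in>{1..n}. u k + w k \<le> m k" and j: "j \<in> {1..n} - {i}"
      have "u i + w i \<le> 3" "u j + w j \<le> 1" "u q + w q \<le> 1"
        using le[rule_format, of i] le[rule_format, of j] le[rule_format, of q] i qi j m1 by auto
      then show "l j u \<le> r j w" "l j w \<le> r j u"
        using j uw(1,2) meet[of u w j] meet[of w u j] meet_q[of u w] meet_q[of w u]
        by (cases "j = q"; simp add: add.commute)+
    next
      fix k assume meets: "\<forall>j\<in>{1..n} - {i}. l j u \<le> r j w \<and> l j w \<le> r j u" and k: "k \<in> {1..n}"
      have nonq: "u j + w j \<le> 1" if "j \<in> {1..n} - {i}" "j \<noteq> q" for j
        using separate[OF uw that] meets that by (meson not_le)
      have agree: "u j = w j"
        if "j \<in> {1..n} - {i}" "j \<noteq> q" "u i + w i > 3 \<or> u q + w q > 1 \<and> u i = 0 \<and> w i = 0" for j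
        using separate[OF uw that(1,2)] meets that by blast
      have meets_q: "l q u \<le> r q w \<and> l q w \<le> r q u" using meets qi by blast
      \<comment> \<open>If \<open>i\<close> is violated, the graph of \<open>q\<close> forces
        agreement in \<open>i\<close> and \<open>q\<close> and the other graphs force agreement
        elsewhere, contradicting \<open>u \<noteq> w\<close>. If \<open>q\<close> is violated, its
        graph forces \<open>u i = w i = 0\<close>, and the argument repeats.\<close>
      have equal: "u = w" if "u i = w i" "u q = w q" "\<And>j. j \<in> {1..n} - {i} \<Longrightarrow> j \<noteq> q \<Longrightarrow> u j = w j"
        by (rule covering_verts_eqI[OF uw(1,2)]) (use that in blast)
      have "u i + w i \<le> 3"
      proof (rule ccontr)
        assume "\<not> u i + w i \<le> 3"
        then have gt: "u i + w i > 3" by simp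
        then have "u i = w i" "u q = w q" using separate_q[OF uw] meets_q by blast+
        then show False using equal agree gt uw(3) by blast
      qed
      moreover have "u q + w q \<le> 1"
      proof (rule ccontr)
        assume "\<not> u q + w q \<le> 1"
        then have gt: "u q + w q > 1" by simp
        then have "u i = 0" "w i = 0" using separate_q[OF uw] meets_q by blast+
        moreover have "u q = w q" using gt valj[OF uw(1) qi] valj[OF uw(2) qi] by auto
        ultimately show False using equal agree gt uw(3) by metis
      qed
      ultimately show "u k + w k \<le> m k" using nonq i(2) m1 k by (metis DiffI singletonD)
    qed
  qed
qed

section \<open>Lower bounds from conflicting nonadjacent pairs\<close>

definition adj :: "nat \<Rightarrow> (nat \<Rightarrow> nat) \<Rightarrow> (nat \<Rightarrow> nat) \<Rightarrow> (nat \<Rightarrow> nat) \<Rightarrow> bool" where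
  "adj n m u w \<longleftrightarrow> (\<forall>i\<in>{1..n}. u i + w i \<le> m i)"

lemma adj_commute: "adj n m u w \<longleftrightarrow> adj n m w u"
  by (simp add: adj_def add.commute)

definition nonedge :: "nat \<Rightarrow> (nat \<Rightarrow> nat) \<Rightarrow> (nat \<Rightarrow> nat) \<Rightarrow> (nat \<Rightarrow> nat) \<Rightarrow> bool" where
  "nonedge n m u w \<longleftrightarrow> u \<in> covering_verts n m \<and> w \<in> covering_verts n m \<and> u \<noteq> w \<and> \<not> adj n m u w"

text \<open>The colour of a nonadjacent pair is one graph separating it. The endpoints are kept
  because the case of all entries 1 needs the intervals themselves, not only the exclusion of
  4-cycles.\<close>

lemma interval_cover_colouring:
  assumes "interval_cover n m J"
  obtains l r :: "'b \<Rightarrow> (nat \<Rightarrow> nat) \<Rightarrow> real" and c :: "(nat \<Rightarrow> nat) \<Rightarrow> (nat \<Rightarrow> nat) \<Rightarrow> 'b"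
  where "\<And>j u. j \<in> J \<Longrightarrow> u \<in> covering_verts n m \<Longrightarrow> l j u \<le> r j u"
    and "\<And>j u w. \<lbrakk>j \<in> J; u \<in> covering_verts n m; w \<in> covering_verts n m; u \<noteq> w; adj n m u w\<rbrakk> \<Longrightarrow> l j u \<le> r j w"
    and "\<And>u w. nonedge n m u w \<Longrightarrow> c u w \<in> J"
    and "\<And>u w. nonedge n m u w \<Longrightarrow> r (c u w) u < l (c u w) w \<or> r (c u w) w < l (c u w) u"
proof -
  let ?V = "covering_verts n m"
  obtain l r where le: "\<And>j u. j \<in> J \<Longrightarrow> u \<in> ?V \<Longrightarrow> l j u \<le> (r j u :: real)"
    and iff: "\<And>u w. \<lbrakk>u \<in> ?V; w \<in> ?V; u \<noteq> w\<rbrakk> \<Longrightarrow>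
      adj n m u w \<longleftrightarrow> (\<forall>j\<in>J. l j u \<le> r j w \<and> l j w \<le> r j u)"
    using assms unfolding interval_cover_def adj_def by blast
  define c where "c u w = (SOME j. j \<in> J \<and> (r j u < l j w \<or> r j w < l j u))" for u w
  have c: "c u w \<in> J \<and> (r (c u w) u < l (c u w) w \<or> r (c u w) w < l (c u w) u)"
    if "nonedge n m u w" for u w
  proof -
    have "\<exists>j. j \<in> J \<and> (r j u < l j w \<or> r j w < l j u)"
      using that iff[of u w] unfolding nonedge_def by (meson not_le)
    then show ?thesis unfolding c_def by (rule someI_ex)
  qed
  show thesis
    by (rule that[of l r c]) (use le iff c in blast)+
qed

text \<open>Two nonadjacent pairs whose four cross pairs are adjacent induce a 4-cycle. It has no
  chord in an interval graph that separates both pairs, which is impossible.\<close>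

lemma interval_cover_conflict:
  assumes "interval_cover n m J"
  obtains c :: "(nat \<Rightarrow> nat) \<Rightarrow> (nat \<Rightarrow> nat) \<Rightarrow> 'b"
  where "\<And>u w. nonedge n m u w \<Longrightarrow> c u w \<in> J"
    and "\<And>a b x y. \<lbrakk>nonedge n m a b; nonedge n m x y;
      adj n m a x; adj n m a y; adj n m b x; adj n m b y\<rbrakk> \<Longrightarrow> c a b \<noteq> c x y"
proof -
  obtain l r c where
    meet: "\<And>j u w. \<lbrakk>j \<in> J; u \<in> covering_verts n m; w \<in> covering_verts n m; u \<noteq> w; adj n m u w\<rbrakk> \<Longrightarrow> l j u \<le> (r j w :: real)"
    and c: "\<And>u w. nonedge n m u w \<Longrightarrow> c u w \<in> J"
    and sep: "\<And>u w. nonedge n m u w \<Longrightarrow> r (c u w) u < l (c u w) w \<or> r (c u w) w < l (c u w) u"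
    using interval_cover_colouring[OF assms] by metis
  show thesis
  proof (rule that[of c])
    fix a b x y
    assume ne: "nonedge n m a b" "nonedge n m x y"
      and adj: "adj n m a x" "adj n m a y" "adj n m b x" "adj n m b y"
    \<comment> \<open>A coincidence such as \<open>a = x\<close> would turn
      \<open>adj n m a y\<close> into adjacency of \<open>x\<close> and \<open>y\<close>.\<close>
    have distinct: "a \<noteq> x" "a \<noteq> y" "b \<noteq> x" "b \<noteq> y"
      using ne adj by (auto simp: nonedge_def adj_commute)
    show "c a b \<noteq> c x y"
    proof
      assume eq: "c a b = c x y"
      let ?j = "c a b"
      have V: "a \<in> covering_verts n m" "b \<in> covering_verts n m"
        "x \<in> covering_verts n m" "y \<in> covering_verts n m"
        using ne by (simp_all add: nonedge_def)
      \<comment> \<open>The intervals of \<open>x\<close> and \<open>y\<close> both bridge the gap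
        between those of \<open>a\<close> and \<open>b\<close>, so they intersect.\<close>
      have "l ?j a \<le> r ?j x" "l ?j x \<le> r ?j a" "l ?j a \<le> r ?j y" "l ?j y \<le> r ?j a"
        "l ?j b \<le> r ?j x" "l ?j x \<le> r ?j b" "l ?j b \<le> r ?j y" "l ?j y \<le> r ?j b"
        using V distinct adj c[OF ne(1)] adj_commute[of n m] by (auto intro!: meet)
      then show False using sep[OF ne(1)] sep[OF ne(2)] unfolding eq[symmetric] by linarith
    qed
  qed (rule c)
qed

text \<open>Any two of the pairs conflict, so the colouring is injective on the family. The fourth
  cross adjacency comes from exchanging \<open>k\<close> and \<open>k'\<close>.\<close>

lemma interval_cover_card_ge:
  assumes cover: "interval_cover n m {1..d}"
    and ne: "\<And>k. k \<in> K \<Longrightarrow> nonedge n m (a k) (b k)"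
    and adj: "\<And>k k'. \<lbrakk>k \<in> K; k' \<in> K; k \<noteq> k'\<rbrakk> \<Longrightarrow>
      adj n m (a k) (a k') \<and> adj n m (a k) (b k') \<and> adj n m (b k) (b k')"
  shows "card K \<le> d"
proof -
  obtain c where c: "\<And>u w. nonedge n m u w \<Longrightarrow> c u w \<in> {1..d}"
    and conflict: "\<And>a b x y. \<lbrakk>nonedge n m a b; nonedge n m x y;
      adj n m a x; adj n m a y; adj n m b x; adj n m b y\<rbrakk> \<Longrightarrow> c a b \<noteq> c x y"
    using interval_cover_conflict[OF cover] by metis
  have "inj_on (\<lambda>k. c (a k) (b k)) K"
  proof (rule inj_onI, rule ccontr)
    fix k k' assume "k \<in> K" "k' \<in> K" "c (a k) (b k) = c (a k') (b k')" "k \<noteq> k'"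
    then show False
      using conflict[OF ne[of k] ne[of k']] adj[of k k'] adj[of k' k] adj_commute[of n m] by metis
  qed
  then have "card K \<le> card {1..d}"
    by (rule card_inj_on_le) (use c ne in auto)
  then show ?thesis by simp
qed

text \<open>The entry at \<open>i\<close> takes precedence, so \<open>vec n i a i 0\<close> is the
  vector whose only possibly nonzero entry is \<open>a\<close> at \<open>i\<close>.\<close>

definition vec :: "nat \<Rightarrow> nat \<Rightarrow> nat \<Rightarrow> nat \<Rightarrow> nat \<Rightarrow> nat \<Rightarrow> nat" where
  "vec n i a k b = (\<lambda>x\<in>{1..n}. if x = i then a else if x = k then b else 0)"

lemma vec_apply: "x \<in> {1..n} \<Longrightarrow> vec n i a k b x = (if x = i then a else if x = k then b else 0)"
  by (simp add: vec_def)

text \<open>\<open>0 < a\<close> excludes the zero vector. To exclude \<open>m\<close>, either one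
  of the two entries is below its bound or there is a coordinate outside \<open>{i, k}\<close>,
  where the entry is 0.\<close>

lemma vec_mem:
  assumes "n \<ge> 2" "\<forall>i\<in>{1..n}. m i \<ge> 1" "i \<in> {1..n}" "k \<in> {1..n}" "0 < a" "a \<le> m i" "b \<le> m k"
    and "k = i \<or> a < m i \<or> b < m k \<or> n \<ge> 3"
  shows "vec n i a k b \<in> covering_verts n m"
proof -
  have "\<exists>x\<in>{1..n}. vec n i a k b x \<noteq> m x"
  proof (cases "a < m i \<or> k \<noteq> i \<and> b < m k")
    case True
    then have "vec n i a k b i \<noteq> m i \<or> vec n i a k b k \<noteq> m k"
      using assms(3,4) by (auto simp: vec_apply)
    then show ?thesis using assms(3,4) by blast
  next
    case False
    then have "card {i, k} < card {1..n}"
      using assms(1,8) by (cases "k = i") auto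
    then have "\<not> {1..n} \<subseteq> {i, k}"
      by (metis card_mono finite.emptyI finite.insertI not_le)
    then obtain x where "x \<in> {1..n}" "x \<noteq> i" "x \<noteq> k" by blast
    moreover from this have "m x \<ge> 1" using assms(2) by blast
    ultimately have "vec n i a k b x \<noteq> m x" by (simp add: vec_apply)
    then show ?thesis using \<open>x \<in> {1..n}\<close> by blast
  qed
  moreover have "vec n i a k b i \<noteq> 0" using assms(3,5) by (simp add: vec_apply)
  moreover have "\<forall>x\<in>{1..n}. vec n i a k b x \<le> m x"
    using assms(6,7) by (simp add: vec_apply)
  moreover have "vec n i a k b \<in> extensional {1..n}" by (simp add: vec_def)
  ultimately show ?thesis using assms(3) unfolding covering_verts_iff by blast
qed

lemma nonedgeI:
  assumes "u \<in> covering_verts n m" "w \<in> covering_verts n m" "u x \<noteq> w x"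
    and "i \<in> {1..n}" "u i + w i > m i"
  shows "nonedge n m u w"
  using assms by (auto simp: nonedge_def adj_def not_le)

text \<open>The pair for \<open>i\<close> has entries \<open>m i - 1\<close> and 2, distinct because
  \<open>m i \<ge> 4\<close>. The pair for another \<open>k\<close> violates \<open>k\<close> and is
  told apart by an entry 1 at \<open>i\<close>, which still fits on top of
  \<open>m i - 1\<close>.\<close>

lemma interval_cover_ge_if_ge_4:
  assumes "n \<ge> 2" "\<forall>i\<in>{1..n}. m i \<ge> 1" "i \<in> {1..n}" "m i \<ge> 4" "interval_cover n m {1..d}"
  shows "n \<le> d"
proof -
  let ?a = "\<lambda>k. if k = i then vec n i (m i - 1) i 0 else vec n k (m k) k 0"
  let ?b = "\<lambda>k. if k = i then vec n i 2 i 0 else vec n k (m k) i 1"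
  have "card {1..n} \<le> d"
  proof (rule interval_cover_card_ge[OF assms(5)])
    fix k assume k: "k \<in> {1..n}"
    then have "m k \<ge> 1" using assms(2) by blast
    then show "nonedge n m (?a k) (?b k)"
      using assms(3,4) k
      by (intro nonedgeI[where i = k and x = i]) (auto intro!: vec_mem[OF assms(1,2)] simp: vec_apply)
  qed (use assms(4) in \<open>auto simp: adj_def vec_apply\<close>)
  then show ?thesis by simp
qed

text \<open>The pairs for \<open>k \<noteq> i\<close> from the case \<open>m i \<ge> 4\<close>
  suffice: their supports overlap only at \<open>i\<close>, where
  \<open>1 + 1 \<le> m i\<close>.\<close>

lemma interval_cover_ge_if_ge_2:
  assumes "n \<ge> 2" "\<forall>i\<in>{1..n}. m i \<ge> 1" "i \<in> {1..n}" "m i \<ge> 2" "interval_cover n m {1..d}"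
  shows "n - 1 \<le> d"
proof -
  have "card ({1..n} - {i}) \<le> d"
  proof (rule interval_cover_card_ge[OF assms(5)])
    fix k assume k: "k \<in> {1..n} - {i}"
    then have "m k \<ge> 1" using assms(2) by blast
    then show "nonedge n m (vec n k (m k) k 0) (vec n k (m k) i 1)"
      using assms(3,4) k
      by (intro nonedgeI[where i = k and x = i]) (auto intro!: vec_mem[OF assms(1,2)] simp: vec_apply)
  qed (use assms(4) in \<open>auto simp: adj_def vec_apply\<close>)
  then show ?thesis using assms(3) by simp
qed

text \<open>Pairs living on different single coordinates have disjoint supports and hence conflict;
  \<open>m k \<ge> 2\<close> makes the entries \<open>m k\<close> and 1 distinct.\<close>

lemma interval_cover_ge_if_all_ge_2:
  assumes "n \<ge> 2" "\<forall>i\<in>{1..n}. m i \<ge> 2" "interval_cover n m {1..d}"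
  shows "n \<le> d"
proof -
  have m1: "\<forall>i\<in>{1..n}. m i \<ge> 1" using assms(2) by (meson le_trans one_le_numeral)
  have "card {1..n} \<le> d"
  proof (rule interval_cover_card_ge[OF assms(3)])
    fix k assume k: "k \<in> {1..n}"
    then have "m k \<ge> 2" using assms(2) by blast
    then show "nonedge n m (vec n k (m k) k 0) (vec n k 1 k 0)"
      using k
      by (intro nonedgeI[where i = k and x = k]) (auto intro!: vec_mem[OF assms(1) m1] simp: vec_apply)
  qed (use m1 in \<open>auto simp: adj_def vec_apply\<close>)
  then show ?thesis by simp
qed

text \<open>For \<open>m i = 3\<close> the entries \<open>m i - 1\<close> and 2 coincide, so the
  pair used for \<open>m i \<ge> 4\<close> collapses. Several pairs violating \<open>i\<close> or
  \<open>j\<close> replace it; their conflicts rule out \<open>n - 1\<close> colours.\<close>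

lemma interval_cover_ge_if_3_2:
  assumes "n \<ge> 2" "\<forall>i\<in>{1..n}. m i \<ge> 1" "i \<in> {1..n}" "m i = 3" "j \<in> {1..n}" "j \<noteq> i" "m j \<ge> 2"
    and cover: "interval_cover n m {1..d}"
  shows "n \<le> d"
proof (rule ccontr)
  assume "\<not> n \<le> d"
  then have d: "d \<le> n - 1" by simp
  obtain c where c: "\<And>u w. nonedge n m u w \<Longrightarrow> c u w \<in> {1..d}"
    and conflict: "\<And>a b x y. \<lbrakk>nonedge n m a b; nonedge n m x y;
      adj n m a x; adj n m a y; adj n m b x; adj n m b y\<rbrakk> \<Longrightarrow> c a b \<noteq> c x y"
    using interval_cover_conflict[OF cover] by metis
  let ?K = "{1..n} - {i, j}"
  let ?e = "\<lambda>k a. vec n k a k 0" and ?e2 = "vec n"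
  have mk: "m k \<ge> 1" if "k \<in> ?K" for k using assms(2) that by blast
  note mem = vec_mem[OF assms(1,2)]
  have ne_j: "nonedge n m (?e j (m j)) (?e j 1)"
    by (rule nonedgeI[where i = j and x = j]) (use assms(3-7) in \<open>auto intro!: mem simp: vec_apply\<close>)
  have ne_i: "nonedge n m (?e i 3) (?e i 1)"
    by (rule nonedgeI[where i = i and x = i]) (use assms(3-7) in \<open>auto intro!: mem simp: vec_apply\<close>)
  have ne_ij: "nonedge n m (?e i 2) (?e2 i 2 j 1)"
    by (rule nonedgeI[where i = i and x = j]) (use assms(3-7) in \<open>auto intro!: mem simp: vec_apply\<close>)
  have ne_ki: "nonedge n m (?e k (m k)) (?e2 k (m k) i 1)" if "k \<in> ?K" for k
    by (rule nonedgeI[where i = k and x = i])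
      (use assms(3-7) mk[OF that] that in \<open>auto intro!: mem simp: vec_apply\<close>)
  have ne_kj: "nonedge n m (?e k (m k)) (?e2 k (m k) j 1)" if "k \<in> ?K" for k
    by (rule nonedgeI[where i = k and x = j])
      (use assms(3-7) mk[OF that] that in \<open>auto intro!: mem simp: vec_apply\<close>)
  \<comment> \<open>Forced colours: the \<open>f k\<close> and \<open>cj\<close> use up all \<open>n - 1\<close> colours. Then \<open>ci = f k\<close> for some \<open>k\<close>, and this
    \<open>k\<close> closes the five-cycle \<open>cj\<close>, \<open>ci\<close>, \<open>g k\<close>, \<open>cij\<close>, \<open>f k\<close> of conflicts, in which \<open>g k\<close> and \<open>cij\<close> can
    only get the colour \<open>cj\<close>.\<close>
  define f where "f k = c (?e k (m k)) (?e2 k (m k) i 1)" for k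
  define g where "g k = c (?e k (m k)) (?e2 k (m k) j 1)" for k
  define cj where "cj = c (?e j (m j)) (?e j 1)"
  define ci where "ci = c (?e i 3) (?e i 1)"
  define cij where "cij = c (?e i 2) (?e2 i 2 j 1)"
  have "inj_on f ?K"
  proof (rule inj_onI, rule ccontr)
    fix k k' assume k: "k \<in> ?K" "k' \<in> ?K" and "f k = f k'" "k \<noteq> k'"
    moreover from this have "f k \<noteq> f k'" unfolding f_def using assms(3-7)
      by (intro conflict ne_ki) (auto simp: adj_def vec_apply)
    ultimately show False by blast
  qed
  have fg: "g k \<noteq> f k'" if "k \<in> ?K" "k' \<in> ?K" "k \<noteq> k'" for k k'
    unfolding f_def g_def using assms(3-7) that
    by (intro conflict ne_ki ne_kj) (auto simp: adj_def vec_apply)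
  have cj_f: "cj \<noteq> f k" if "k \<in> ?K" for k
    unfolding f_def cj_def using assms(3-7) that
    by (intro conflict ne_ki ne_j) (auto simp: adj_def vec_apply)
  have ci_cj: "ci \<noteq> cj"
    unfolding ci_def cj_def using assms(3-7)
    by (intro conflict ne_i ne_j) (auto simp: adj_def vec_apply)
  have ci_g: "ci \<noteq> g k" if "k \<in> ?K" for k
    unfolding g_def ci_def using assms(3-7) that
    by (intro conflict ne_kj ne_i) (auto simp: adj_def vec_apply)
  have cij_f: "cij \<noteq> f k" if "k \<in> ?K" for k
    unfolding f_def cij_def using assms(3-7) that
    by (intro conflict ne_ki ne_ij) (auto simp: adj_def vec_apply)
  have cij_g: "cij \<noteq> g k" if "k \<in> ?K" for k
    unfolding g_def cij_def using assms(3-7) that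
    by (intro conflict ne_kj ne_ij) (auto simp: adj_def vec_apply)
  have sub: "insert cj (f ` ?K) \<subseteq> {1..d}"
    unfolding f_def cj_def using c[OF ne_j] c[OF ne_ki] by blast
  have "cj \<notin> f ` ?K" using cj_f by blast
  then have "card (insert cj (f ` ?K)) = Suc (card ?K)"
    using card_image[OF \<open>inj_on f ?K\<close>] by (simp add: card_insert_disjoint)
  also have "card ?K = n - 2"
    using assms(3,5,6) by (simp add: card_Diff_subset)
  finally have "d \<le> card (insert cj (f ` ?K))" using d assms(1) by simp
  then have all: "insert cj (f ` ?K) = {1..d}"
    using sub by (intro card_seteq) auto
  have "ci \<in> insert cj (f ` ?K)" unfolding all ci_def by (rule c[OF ne_i])
  then obtain k where k: "k \<in> ?K" "ci = f k" using ci_cj by blast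
  have "g k \<noteq> f k'" if "k' \<in> ?K" for k'
    using fg[OF k(1) that] ci_g[OF k(1)] k(2) by metis
  moreover have "g k \<in> insert cj (f ` ?K)" unfolding all g_def by (rule c[OF ne_kj[OF k(1)]])
  ultimately have "g k = cj" by blast
  moreover have "cij \<in> insert cj (f ` ?K)" unfolding all cij_def by (rule c[OF ne_ij])
  then have "cij = cj" using cij_f by blast
  ultimately show False using cij_g[OF k(1)] by simp
qed

section \<open>All entries 1: counting coloured arcs\<close>

text \<open>Induction on the number of colours. A colour whose arcs all pass through one vertex is
  deleted together with that vertex. If there is no such colour, every colour has at most five arcs,
  too few for all ordered pairs.\<close>

lemma arc_colouring_card_le:
  fixes c :: "'a \<Rightarrow> 'a \<Rightarrow> 'b"
  assumes "finite R" "finite C"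
    and "\<And>x y. \<lbrakk>x \<in> R; y \<in> R; x \<noteq> y\<rbrakk> \<Longrightarrow> c x y \<in> C"
    and "\<And>x y z w. \<lbrakk>x \<in> R; y \<in> R; z \<in> R; w \<in> R; x \<noteq> y; z \<noteq> w; {x, y} \<inter> {z, w} = {}\<rbrakk> \<Longrightarrow> c x y \<noteq> c z w"
    and "\<And>x y z k. \<lbrakk>x \<in> R; y \<in> R; z \<in> R; x \<noteq> y; y \<noteq> z; x \<noteq> z;
      {c x y, c y x, c y z, c z y, c x z, c z x} = {k}\<rbrakk> \<Longrightarrow> False"
  shows "card R \<le> card C + 1"
  using assms
proof (induction "card C" arbitrary: C R rule: less_induct)
  case less
  note fin = less.prems(1,2) and inC = less.prems(3) and disj = less.prems(4) and tri = less.prems(5)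
  show ?case
  proof (cases "\<exists>s\<in>R. \<exists>k\<in>C. \<forall>x\<in>R. \<forall>y\<in>R. x \<noteq> y \<longrightarrow> c x y = k \<longrightarrow> s \<in> {x, y}")
    case True
    then obtain s k where sk: "s \<in> R" "k \<in> C"
      and star: "\<And>x y. \<lbrakk>x \<in> R; y \<in> R; x \<noteq> y; c x y = k\<rbrakk> \<Longrightarrow> s \<in> {x, y}" by blast
    have "card (R - {s}) \<le> card (C - {k}) + 1"
    proof (rule less.hyps)
      show "card (C - {k}) < card C" using sk fin by (meson card_Diff1_less)
      show "c x y \<in> C - {k}" if "x \<in> R - {s}" "y \<in> R - {s}" "x \<noteq> y" for x y
        using that inC[of x y] star[of x y] by blast
      show "c x y \<noteq> c z w" if "x \<in> R - {s}" "y \<in> R - {s}" "z \<in> R - {s}" "w \<in> R - {s}"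
        "x \<noteq> y" "z \<noteq> w" "{x, y} \<inter> {z, w} = {}" for x y z w
        using that disj[of x y z w] by blast
      show False if "x \<in> R - {s}" "y \<in> R - {s}" "z \<in> R - {s}" "x \<noteq> y" "y \<noteq> z" "x \<noteq> z"
        "{c x y, c y x, c y z, c z y, c x z, c z x} = {k}" for x y z k
        using that tri[of x y z k] by blast
    qed (use fin in auto)
    moreover have "card R = Suc (card (R - {s}))" "card C = Suc (card (C - {k}))"
      using sk fin by (simp_all only: card.remove)
    ultimately show ?thesis by simp
  next
    case False
    show ?thesis
    proof (rule ccontr)
      assume gt: "\<not> card R \<le> card C + 1"
      \<comment> \<open>The negated claim gives \<open>card R \<ge> 2\<close>, so the subtraction
        does not truncate.\<close>
      define t where "t = card R - 2"
      have t: "card R = t + 2" "card C \<le> t"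
        using gt by (simp_all add: t_def)
      define A where "A k = {(x, y). x \<in> R \<and> y \<in> R \<and> x \<noteq> y \<and> c x y = k}" for k
      have A_meet: "{x, y} \<inter> {z, w} \<noteq> {}" if "(x, y) \<in> A k" "(z, w) \<in> A k" for x y z w k
        using that disj[of x y z w] unfolding A_def by auto
      have A5: "card (A k) \<le> 5" if k: "k \<in> C" for k
      proof -
        have avoid: "\<exists>x y. (x, y) \<in> A k \<and> s \<notin> {x, y}" if "s \<in> R" for s
          using False that k unfolding A_def by blast
        obtain s where "s \<in> R" using t(1) by fastforce
        then obtain a b where ab: "(a, b) \<in> A k" using avoid by blast
        then have abR: "a \<in> R" "b \<in> R" "a \<noteq> b" by (auto simp: A_def)
        obtain x y where xy: "(x, y) \<in> A k" "a \<notin> {x, y}" using avoid[OF abR(1)] by blast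
        \<comment> \<open>An arc avoiding \<open>a\<close> still meets \<open>(a, b)\<close>, so it
          contains \<open>b\<close>; its other end is the third corner of the triangle.\<close>
        obtain z where z: "{x, y} = {b, z}" "z \<noteq> a" "z \<noteq> b" "z \<in> R"
        proof (cases "x = b")
          case True
          show ?thesis by (rule that[of y]) (use True xy in \<open>auto simp: A_def\<close>)
        next
          case False
          then have "y = b" using A_meet[OF ab xy(1)] xy(2) by auto
          then show ?thesis by (intro that[of x]) (use xy in \<open>auto simp: A_def\<close>)
        qed
        obtain x' y' where xy': "(x', y') \<in> A k" "b \<notin> {x', y'}" using avoid[OF abR(2)] by blast
        have az: "{x', y'} = {a, z}"
          using A_meet[OF ab xy'(1)] A_meet[OF xy(1) xy'(1)] xy'(2) z by auto
        let ?S = "{(a, b), (b, a), (b, z), (z, b), (a, z), (z, a)}"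
        \<comment> \<open>An arc meeting all three sides of the triangle has both ends among its
          corners.\<close>
        have "A k \<subseteq> ?S"
        proof
          fix p assume p: "p \<in> A k"
          obtain v w where vw: "p = (v, w)" by (cases p)
          have "{v, w} \<inter> {a, b} \<noteq> {}" "{v, w} \<inter> {b, z} \<noteq> {}" "{v, w} \<inter> {a, z} \<noteq> {}"
            using A_meet[OF _ ab] A_meet[OF _ xy(1)] A_meet[OF _ xy'(1)] p vw z(1) az by auto
          moreover have "v \<noteq> w" using p vw by (simp add: A_def)
          ultimately show "p \<in> ?S" using vw abR(3) z(2,3) by auto
        qed
        moreover have "A k \<noteq> ?S"
        proof
          assume eq: "A k = ?S"
          have "{c a b, c b a, c b z, c z b, c a z, c z a} = {k}"
          proof -
            have "c v w = k" if "(v, w) \<in> ?S" for v w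
              using that unfolding eq[symmetric] by (simp add: A_def)
            then show ?thesis by simp
          qed
          then show False using tri[of a b z k] abR z by blast
        qed
        ultimately have "A k \<subset> ?S" by blast
        then have "card (A k) < card ?S" by (intro psubset_card_mono) auto
        also have "card ?S \<le> 6" using card_length[of "[(a, b), (b, a), (b, z), (z, b), (a, z), (z, a)]"] by simp
        finally show ?thesis by simp
      qed
      have "R \<times> R - Id_on R \<subseteq> (\<Union>k\<in>C. A k)"
        using inC unfolding A_def by auto
      moreover have "finite (\<Union>k\<in>C. A k)"
        by (rule finite_subset[of _ "R \<times> R"]) (use fin in \<open>auto simp: A_def\<close>)
      ultimately have "card (R \<times> R - Id_on R) \<le> card (\<Union>k\<in>C. A k)" by (rule card_mono[rotated])
      also have "\<dots> \<le> (\<Sum>k\<in>C. card (A k))" by (rule card_UN_le[OF fin(2)])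
      also have "\<dots> \<le> (\<Sum>k\<in>C. 5)" by (rule sum_mono) (rule A5)
      also have "\<dots> \<le> 5 * t" using t by simp
      also have "card (R \<times> R - Id_on R) = (t + 2) * (t + 2) - (t + 2)"
      proof -
        have "Id_on R = (\<lambda>x. (x, x)) ` R" by auto
        then have "card (Id_on R) = card R" "finite (Id_on R)"
          using fin(1) by (simp_all add: card_image inj_on_def)
        moreover have "Id_on R \<subseteq> R \<times> R" by auto
        ultimately show ?thesis using t(1)
          by (simp add: card_Diff_subset card_cartesian_product)
      qed
      finally have "(t + 2) * (t + 2) \<le> 5 * t + (t + 2)" by simp
      \<comment> \<open>Integers allow completing the square with \<open>t - 1\<close>. Six arcs per
        colour would not do: the count would then leave \<open>t = 1\<close> and
        \<open>t = 2\<close> open.\<close>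
      then have "int t * int t + 2 \<le> 2 * int t" by (simp add: algebra_simps flip: of_nat_mult of_nat_add)
      then have "(int t - 1)\<^sup>2 + 1 \<le> 0" by (simp add: power2_eq_square algebra_simps)
      then show False using zero_le_power2[of "int t - 1"] by linarith
    qed
  qed
qed

text \<open>The arc \<open>(x, y)\<close> stands for the nonadjacent pair with supports
  \<open>{x}\<close> and \<open>{x, y}\<close>; the latter is a vertex because
  \<open>n \<ge> 3\<close>. The arc bound is then applied with the graphs as colours.\<close>

lemma interval_cover_ge_if_all_1:
  assumes n: "n \<ge> 3" and m1: "\<forall>i\<in>{1..n}. m i = 1" and cover: "interval_cover n m {1..d}"
  shows "n - 1 \<le> d"
proof (rule interval_cover_colouring[OF cover])
  fix l r :: "nat \<Rightarrow> (nat \<Rightarrow> nat) \<Rightarrow> real" and c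
  assume le: "\<And>j u. j \<in> {1..d} \<Longrightarrow> u \<in> covering_verts n m \<Longrightarrow> l j u \<le> r j u"
    and meet: "\<And>j u w. \<lbrakk>j \<in> {1..d}; u \<in> covering_verts n m; w \<in> covering_verts n m; u \<noteq> w; adj n m u w\<rbrakk> \<Longrightarrow> l j u \<le> r j w"
    and c: "\<And>u w. nonedge n m u w \<Longrightarrow> c u w \<in> {1..d}"
    and sep: "\<And>u w. nonedge n m u w \<Longrightarrow> r (c u w) u < l (c u w) w \<or> r (c u w) w < l (c u w) u"
  have n2: "n \<ge> 2" and mge: "\<forall>i\<in>{1..n}. m i \<ge> 1" using n m1 by auto
  let ?s = "\<lambda>x. vec n x 1 x 0" and ?t = "\<lambda>x y. vec n x 1 y 1"
  have mem: "?s x \<in> covering_verts n m" "?t x y \<in> covering_verts n m"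
    if "x \<in> {1..n}" "y \<in> {1..n}" for x y
    using that m1 n by (auto intro!: vec_mem[OF n2 mge])
  \<comment> \<open>Opposite arcs share the interval of \<open>{x, y}\<close>, so the six arcs of a
    triangle involve only six intervals.\<close>
  have t_commute: "?t x y = ?t y x" for x y
    by (auto simp: vec_def)
  have ne: "nonedge n m (?s x) (?t x y)" if "x \<in> {1..n}" "y \<in> {1..n}" "x \<noteq> y" for x y
    by (rule nonedgeI[where i = x and x = y]) (use mem that m1 in \<open>auto simp: vec_apply\<close>)
  have meetI: "l j u \<le> r j w \<and> l j w \<le> r j u"
    if "j \<in> {1..d}" "u \<in> covering_verts n m" "w \<in> covering_verts n m" "u x \<noteq> w x" "adj n m u w" for j u w x
    using that meet[of j u w] meet[of j w u] adj_commute[of n m u w] by metis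
  have "card {1..n} \<le> card {1..d} + 1"
  proof (rule arc_colouring_card_le[of _ _ "\<lambda>x y. c (?s x) (?t x y)"])
    fix x y z w
    assume in_n: "x \<in> {1..n}" "y \<in> {1..n}" "z \<in> {1..n}" "w \<in> {1..n}"
      and distinct: "x \<noteq> y" "z \<noteq> w" "{x, y} \<inter> {z, w} = {}"
    show "c (?s x) (?t x y) \<noteq> c (?s z) (?t z w)"
    proof
      assume eq: "c (?s x) (?t x y) = c (?s z) (?t z w)"
      let ?j = "c (?s x) (?t x y)"
      have j: "?j \<in> {1..d}" using c ne in_n distinct by blast
      \<comment> \<open>Disjoint arcs have disjoint supports, so all four cross pairs are adjacent
        and the 4-cycle argument applies.\<close>
      have "l ?j u \<le> r ?j v \<and> l ?j v \<le> r ?j u" if "u \<in> {?s x, ?t x y}" "v \<in> {?s z, ?t z w}" for u v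
        by (rule meetI[OF j, where x = x])
          (use that in_n distinct mem m1 in \<open>auto simp: vec_apply adj_def\<close>)
      then show False
        using sep[OF ne[of x y]] sep[OF ne[of z w]] in_n distinct unfolding eq[symmetric]
        by (smt (verit, best) insertCI)
    qed
  next
    fix x y z k
    assume in_n: "x \<in> {1..n}" "y \<in> {1..n}" "z \<in> {1..n}" and distinct: "x \<noteq> y" "y \<noteq> z" "x \<noteq> z"
      and "{c (?s x) (?t x y), c (?s y) (?t y x), c (?s y) (?t y z), c (?s z) (?t z y),
        c (?s x) (?t x z), c (?s z) (?t z x)} = {k}"
    then have k: "c (?s x) (?t x y) = k" "c (?s y) (?t y x) = k" "c (?s y) (?t y z) = k"
      "c (?s z) (?t z y) = k" "c (?s x) (?t x z) = k" "c (?s z) (?t z x) = k" by blast+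
    have kd: "k \<in> {1..d}" using c[OF ne[OF in_n(1,2) distinct(1)]] k(1) by simp
    have ss: "l k (?s a) \<le> r k (?s b)" if "a \<in> {1..n}" "b \<in> {1..n}" "a \<noteq> b" for a b
      using meetI[OF kd mem(1)[OF that(1,1)] mem(1)[OF that(2,2)], of a] that m1
      by (auto simp: vec_apply adj_def)
    have st: "l k (?s a) \<le> r k (?t b e) \<and> l k (?t b e) \<le> r k (?s a)"
      if "a \<in> {1..n}" "b \<in> {1..n}" "e \<in> {1..n}" "a \<noteq> b" "a \<noteq> e" for a b e
      using meetI[OF kd mem(1)[OF that(1,1)] mem(2)[OF that(2,3)], of a] that m1
      by (auto simp: vec_apply adj_def)
    have disj: "r k (?s a) < l k (?t a b) \<or> r k (?t a b) < l k (?s a)"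
      if "a \<in> {1..n}" "b \<in> {1..n}" "a \<noteq> b" "c (?s a) (?t a b) = k" for a b
      using sep[OF ne[OF that(1-3)]] that(4) by simp
    have "r k (?s x) < l k (?t x y) \<or> r k (?t x y) < l k (?s x)"
      "r k (?s y) < l k (?t x y) \<or> r k (?t x y) < l k (?s y)"
      "r k (?s y) < l k (?t y z) \<or> r k (?t y z) < l k (?s y)"
      "r k (?s z) < l k (?t y z) \<or> r k (?t y z) < l k (?s z)"
      "r k (?s x) < l k (?t x z) \<or> r k (?t x z) < l k (?s x)"
      "r k (?s z) < l k (?t x z) \<or> r k (?t x z) < l k (?s z)"
      using disj[OF in_n(1,2)] disj[OF in_n(2,1)] disj[OF in_n(2,3)] disj[OF in_n(3,2)]
        disj[OF in_n(1,3)] disj[OF in_n(3,1)] distinct k t_commute by auto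
    \<comment> \<open>The intervals of \<open>x\<close>, \<open>y\<close>, \<open>z\<close> share a point that none of the three other intervals contains;
      two of those lie on the same side of it, and this is impossible.\<close>
    then show False
      using ss[OF in_n(1,2)] ss[OF in_n(2,1)] ss[OF in_n(2,3)] ss[OF in_n(3,2)] ss[OF in_n(1,3)]
        ss[OF in_n(3,1)] st[OF in_n(1,2,3)] st[OF in_n(2,1,3)] st[OF in_n(3,1,2)] distinct
        le[OF kd mem(2)[OF in_n(1,2)]] le[OF kd mem(2)[OF in_n(2,3)]] le[OF kd mem(2)[OF in_n(1,3)]]
      by (smt (verit, best))
  qed (use c ne in auto)
  then show "n - 1 \<le> d" by simp
qed

section \<open>Assembling the six cases\<close>

theorem theorem42:
  fixes n :: nat and m :: "nat \<Rightarrow> nat"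
  assumes "n \<ge> 2" and "\<forall>i\<in>{1..n}. m i \<ge> 1"
  shows
    "let b = boxicity (covering_verts n m) (covering_edges n m) in
     ((\<exists>i\<in>{1..n}. m i \<ge> 4) \<longrightarrow> b = n) \<and>
     ((\<exists>i\<in>{1..n}. m i = 3 \<and> (\<exists>j\<in>{1..n} - {i}. m j \<ge> 2)) \<longrightarrow> b = n) \<and>
     ((\<exists>i\<in>{1..n}. m i = 3 \<and> (\<forall>j\<in>{1..n} - {i}. m j = 1)) \<longrightarrow> b = n - 1) \<and>
     ((\<forall>i\<in>{1..n}. m i = 2) \<longrightarrow> b = n) \<and>
     ((\<forall>i\<in>{1..n}. m i \<in> {1, 2}) \<and> \<not> (\<forall>i\<in>{1..n}. m i = 2) \<and> \<not> (n = 2 \<and> m 1 = 1 \<and> m 2 = 1)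
        \<longrightarrow> b = n - 1) \<and>
     (n = 2 \<and> m 1 = 1 \<and> m 2 = 1 \<longrightarrow> b = 0)"
proof -
  let ?b = "boxicity (covering_verts n m) (covering_edges n m)"
  have eq_n: "?b = n" if "\<And>d. interval_cover n m {1..d} \<Longrightarrow> n \<le> d"
    using boxicity_covering_eqI[OF interval_cover_upper[OF assms(2)]] that by simp
  have eq_pred: "?b = n - 1"
    if "i \<in> {1..n}" "interval_cover n m ({1..n} - {i})" "\<And>d. interval_cover n m {1..d} \<Longrightarrow> n - 1 \<le> d" for i
    using boxicity_covering_eqI[OF that(2)] that(1,3) by simp
  have ge_4: "?b = n" if "i \<in> {1..n}" "m i \<ge> 4" for i
    by (rule eq_n) (rule interval_cover_ge_if_ge_4[OF assms that])
  have three_two: "?b = n" if "i \<in> {1..n}" "m i = 3" "j \<in> {1..n} - {i}" "m j \<ge> 2" for i j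
    by (rule eq_n) (rule interval_cover_ge_if_3_2[OF assms that(1,2) _ _ that(4)]; use that(3) in simp)
  have three_one: "?b = n - 1" if i: "i \<in> {1..n}" "m i = 3" and "\<forall>j\<in>{1..n} - {i}. m j = 1" for i
  proof -
    obtain q where "q \<in> {1..n}" "q \<noteq> i"
    proof (cases "i = 1")
      case True
      show ?thesis by (rule that[of 2]) (use assms(1) True in auto)
    next
      case False
      show ?thesis by (rule that[of 1]) (use assms(1) False in auto)
    qed
    then show ?thesis
      using eq_pred[OF i(1) interval_cover_three_one[OF i _ _ \<open>\<forall>j\<in>{1..n} - {i}. m j = 1\<close>]]
        interval_cover_ge_if_ge_2[OF assms i(1)] i(2) by simp
  qed
  have all_two: "?b = n" if "\<forall>i\<in>{1..n}. m i = 2"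
    by (rule eq_n) (rule interval_cover_ge_if_all_ge_2[OF assms(1)], use that in auto)
  have one_two: "?b = n - 1" if m12: "\<forall>i\<in>{1..n}. m i \<in> {1, 2}" and not2: "\<not> (\<forall>i\<in>{1..n}. m i = 2)"
    and not11: "\<not> (n = 2 \<and> m 1 = 1 \<and> m 2 = 1)"
  proof -
    obtain p where p: "p \<in> {1..n}" "m p = 1" using m12 not2 by blast
    show ?thesis
    proof (rule eq_pred[OF p(1) interval_cover_one_two[OF p m12]])
      fix d :: nat assume d: "interval_cover n m {1..d}"
      show "n - 1 \<le> d"
      proof (cases "\<exists>i\<in>{1..n}. m i \<ge> 2")
        case True
        then show ?thesis using interval_cover_ge_if_ge_2[OF assms _ _ d] by blast
      next
        case False
        have all1: "\<forall>i\<in>{1..n}. m i = 1"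
        proof
          fix i assume "i \<in> {1..n}"
          then have "m i = 1 \<or> m i = 2" "\<not> m i \<ge> 2" using m12 False by blast+
          then show "m i = 1" by auto
        qed
        then have "n \<noteq> 2" using not11 by auto
        then show ?thesis using interval_cover_ge_if_all_1[OF _ all1 d] assms(1) by simp
      qed
    qed
  qed
  have one_one: "?b = 0" if n: "n = 2" and m: "m 1 = 1" "m 2 = 1"
  proof -
    have n12: "{1..n} = {1, 2}" using n by auto
    \<comment> \<open>The only vertices are (1, 0) and (0, 1). They are adjacent, so the empty
      family suffices.\<close>
    have "interval_cover n m ({} :: nat set)"
      unfolding interval_cover_def
    proof (rule exI[of _ "\<lambda>_ _. 0"], rule exI[of _ "\<lambda>_ _. 0"], intro conjI ballI impI)
      fix u w assume uw: "u \<in> covering_verts n m" "w \<in> covering_verts n m" "u \<noteq> w"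
      have "(u 1 = 1 \<and> u 2 = 0) \<or> (u 1 = 0 \<and> u 2 = 1)" "(w 1 = 1 \<and> w 2 = 0) \<or> (w 1 = 0 \<and> w 2 = 1)"
        using uw(1,2) m unfolding covering_verts_iff n12 by auto
      moreover have "\<not> (u 1 = w 1 \<and> u 2 = w 2)"
        using covering_verts_eqI[OF uw(1,2)] uw(3) unfolding n12 by auto
      ultimately show "(\<forall>i\<in>{1..n}. u i + w i \<le> m i) \<longleftrightarrow> (\<forall>j\<in>{}. (0 :: real) \<le> 0 \<and> (0 :: real) \<le> 0)"
        using m unfolding n12 by auto
    qed auto
    from boxicity_covering_eqI[OF this] show ?thesis by simp
  qed
  show ?thesis
    unfolding Let_def
  proof (intro conjI impI)
    show "?b = n" if "\<exists>i\<in>{1..n}. m i \<ge> 4"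
      using that ge_4 by blast
    show "?b = n" if "\<exists>i\<in>{1..n}. m i = 3 \<and> (\<exists>j\<in>{1..n} - {i}. m j \<ge> 2)"
      using that three_two by blast
    show "?b = n - 1" if "\<exists>i\<in>{1..n}. m i = 3 \<and> (\<forall>j\<in>{1..n} - {i}. m j = 1)"
      using that three_one by blast
    show "?b = n" if "\<forall>i\<in>{1..n}. m i = 2"
      by (rule all_two[OF that])
    show "?b = n - 1" if "(\<forall>i\<in>{1..n}. m i \<in> {1, 2}) \<and> \<not> (\<forall>i\<in>{1..n}. m i = 2) \<and> \<not> (n = 2 \<and> m 1 = 1 \<and> m 2 = 1)"
      by (rule one_two) (use that in blast)+
    show "?b = 0" if "n = 2 \<and> m 1 = 1 \<and> m 2 = 1"
      by (rule one_one) (use that in blast)+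
  qed
qed

end
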